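(* For all $n\geq 2$: $\mathrm{BWT}_2^{(n-1)}\equiv_{sW}\mathrm{C}_2^{(n)}\leq_{sW}\mathrm{CSRT}_{n,2}$.
   Context: Weihrauch framework. A represented space is a set $X$ with a surjective partial map $\delta_X:\subseteq\mathbb{N}^{\mathbb{N}}\to X$. A problem is a partial multi-valued function $f:\subseteq X\rightrightarrows Y$ between represented spaces; a partial $F:\subseteq\mathbb{N}^{\mathbb{N}}\to\mathbb{N}^{\mathbb{N}}$ realizes $f$ if $\delta_Y(F(p))\in f(\delta_X(p))$ whenever $\delta_X(p)\in\mathrm{dom}(f)$. $\langle\cdot,\cdot\rangle$ is a standard computable pairing on Baire space, and $\langle p_0,p_1,\dots\rangle$ the standard tupling with $\langle p_0,p_1,\dots\rangle\langle n,k\rangle=p_n(k)$. $f\leq_{sW}g$ (strong Weihrauch reducibility) means there are computable partial $H,K:\subseteq\mathbb{N}^{\mathbb{N}}\to\mathbb{N}^{\mathbb{N}}$ such that $H\circ G\circ K$ realizes $f$ for every realizer $G$ of $g$; $\equiv_{sW}$ means reducibility in both directions. Let $\lim:\subseteq\mathbb{N}^{\mathbb{N}}\to\mathbb{N}^{\mathbb{N}}$, $\langle p_0,p_1,\dots\rangle\mapsto\lim_{i}p_i$ (pointwise limit, where it exists). The jump $f'$ of $f:\subseteq X\rightrightarrows Y$ is the same multi-valued map but with input representation $\delta_X\circ\lim$; $f^{(n)}$ is the $n$-fold jump. Problems. $\mathrm{C}_2$ (closed choice on $\{0,1\}$): the input is a nonempty set $A\subseteq\{0,1\}$, given by an enumeration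 of its complement; any element of $A$ is a valid output. $\mathrm{BWT}_2:\{0,1\}^{\mathbb{N}}\rightrightarrows\{0,1\}$ maps a binary sequence to the set of values occurring infinitely often in it. Ramsey. For $n\geq1$, $[\mathbb{N}]^n$ is the set of $n$-element subsets of $\mathbb{N}$; $k$ is identified with $\{0,\dots,k-1\}$. $\mathcal{C}_{n,k}$ is the set of colorings $c:[\mathbb{N}]^n\to k$, represented by names $p$ with $p(i)=c(\vartheta_n(i))$ for a fixed standard computable bijection $\vartheta_n:\mathbb{N}\to[\mathbb{N}]^n$. $M\subseteq\mathbb{N}$ is homogeneous for $c$ if $c$ is constant on $[M]^n$; the constant value is denoted $c(M)$. $c$ is stable if $\lim_{i\to\infty}c(A\cup\{i\})$ exists for every $A\in[\mathbb{N}]^{n-1}$. $\mathrm{CSRT}_{n,k}:\subseteq\mathcal{C}_{n,k}\rightrightarrows k\times2^{\mathbb{N}}$ is defined on stable colorings and maps $c$ to $\{(c(M),M): M$ an infinite homogeneous set for $c\}$, where sets are given by their characteristic functions. *)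

theory Defs
  imports Complex_Main "HOL-Library.Nat_Bijection" "HOL-Library.FuncSet" "HOL-Library.Ramsey"
begin

section \<open>Computability on Baire space\<close>

type_synonym baire = "nat \<Rightarrow> nat"

text \<open>Kleene's partial recursive functions relative to an oracle \<open>p\<close>. The judgement
  \<open>eval p e xs y\<close> says that \<open>e\<close>, run with oracle \<open>p\<close> on the arguments \<open>xs\<close>, halts with value
  \<open>y\<close>. Arguments of the wrong number simply make the computation diverge or are ignored.\<close>

datatype recf =
    Zero
  | Succ
  | Proj nat
  | Oracle
  | Comp recf "recf list"
  | PrimRec recf recf
  | Mu recf

inductive eval :: "baire \<Rightarrow> recf \<Rightarrow> nat list \<Rightarrow> nat \<Rightarrow> bool" for p :: baire where
  eval_Zero: "eval p Zero xs 0"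
| eval_Succ: "eval p Succ [x] (Suc x)"
| eval_Proj: "i < length xs \<Longrightarrow> eval p (Proj i) xs (xs ! i)"
| eval_Oracle: "eval p Oracle [x] (p x)"
| eval_Comp: "list_all2 (\<lambda>g y. eval p g xs y) gs ys \<Longrightarrow> eval p f ys z
    \<Longrightarrow> eval p (Comp f gs) xs z"
| eval_PrimRec_0: "eval p f xs y \<Longrightarrow> eval p (PrimRec f g) (0 # xs) y"
| eval_PrimRec_Suc: "eval p (PrimRec f g) (n # xs) y \<Longrightarrow> eval p g (n # y # xs) z
    \<Longrightarrow> eval p (PrimRec f g) (Suc n # xs) z"
| eval_Mu: "eval p f (n # xs) 0 \<Longrightarrow> (\<forall>m<n. \<exists>y. eval p f (m # xs) (Suc y))
    \<Longrightarrow> eval p (Mu f) xs n"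

inductive_cases eval_CompE: "eval p (Comp f gs) xs z"

lemma eval_deterministic: "eval p e xs y \<Longrightarrow> eval p e xs z \<Longrightarrow> y = z"
proof (induction arbitrary: z rule: eval.induct)
  case (eval_Zero xs)
  then show ?case by (cases rule: eval.cases) auto
next
  case (eval_Succ x)
  then show ?case by (cases rule: eval.cases) auto
next
  case (eval_Proj i xs)
  from eval_Proj.prems show ?case by (cases rule: eval.cases) auto
next
  case (eval_Oracle x)
  then show ?case by (cases rule: eval.cases) auto
next
  case (eval_Comp xs gs ys f y)
  from eval_Comp.prems obtain ws where
    ws: "list_all2 (\<lambda>g y. eval p g xs y) gs ws" "eval p f ws z"
    by (rule eval_CompE)
  have "ws = ys"
  proof (rule nth_equalityI)
    show "length ws = length ys"
      using list_all2_lengthD[OF ws(1)] list_all2_lengthD[OF eval_Comp.IH(1)] by simp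
  next
    fix i assume "i < length ws"
    then have i: "i < length gs" using list_all2_lengthD[OF ws(1)] by simp
    show "ws ! i = ys ! i"
    proof -
      have "\<forall>z. eval p (gs ! i) xs z \<longrightarrow> ys ! i = z"
        using list_all2_nthD[OF eval_Comp.IH(1) i] by (rule conjunct2)
      moreover have "eval p (gs ! i) xs (ws ! i)"
        using list_all2_nthD[OF ws(1) i] .
      ultimately show ?thesis by metis
    qed
  qed
  with ws(2) have "eval p f ys z" by simp
  then show ?case by (rule eval_Comp.IH(2))
next
  case (eval_PrimRec_0 f xs y g)
  from eval_PrimRec_0.prems have "eval p f xs z" by (cases rule: eval.cases) auto
  then show ?case by (rule eval_PrimRec_0.IH)
next
  case (eval_PrimRec_Suc f g n xs y z')
  from eval_PrimRec_Suc.prems obtain w where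
    "eval p (PrimRec f g) (n # xs) w" "eval p g (n # w # xs) z"
    by (cases rule: eval.cases) auto
  then show ?case using eval_PrimRec_Suc.IH by blast
next
  case (eval_Mu f n xs)
  from eval_Mu.prems have z: "eval p f (z # xs) 0" "\<forall>m<z. \<exists>y. eval p f (m # xs) (Suc y)"
    by (cases rule: eval.cases; simp)+
  show ?case
  proof (rule linorder_cases[of n z])
    assume "n < z"
    then show ?thesis using z(2) eval_Mu.IH(1) by blast
  next
    assume "z < n"
    then show ?thesis using z(1) eval_Mu.IH(2) by blast
  qed
qed

text \<open>A partial map on Baire space is computable if one program computes it on all of its domain;
  its behaviour outside the domain is unconstrained.\<close>

definition computable :: "(baire \<Rightarrow> baire option) \<Rightarrow> bool" where
  "computable F \<longleftrightarrow> (\<exists>e. \<forall>p q. F p = Some q \<longrightarrow> (\<forall>n. eval p e [n] (q n)))"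


section \<open>Represented spaces, problems and strong Weihrauch reducibility\<close>

text \<open>A represented space is given by its representation \<open>\<delta>\<close> alone, the underlying set being
  \<open>ran \<delta>\<close>. The domain of the multi-valued map of a problem \<open>P\<close> is \<open>{x. mmap P x \<noteq> {}}\<close>.\<close>

type_synonym 'a representation = "baire \<Rightarrow> 'a option"

record ('a, 'b) problem =
  in_rep :: "'a representation"
  out_rep :: "'b representation"
  mmap :: "'a \<Rightarrow> 'b set"

definition realizes :: "(baire \<Rightarrow> baire option) \<Rightarrow> ('a, 'b) problem \<Rightarrow> bool" where
  "realizes F P \<longleftrightarrow>
    (\<forall>p x. in_rep P p = Some x \<and> mmap P x \<noteq> {} \<longrightarrow>
      (\<exists>q y. F p = Some q \<and> out_rep P q = Some y \<and> y \<in> mmap P x))"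

definition sW_le :: "('a, 'b) problem \<Rightarrow> ('c, 'd) problem \<Rightarrow> bool"
    (infix "\<le>\<^sub>s\<^sub>W" 50) where
  "f \<le>\<^sub>s\<^sub>W g \<longleftrightarrow>
    (\<exists>H K. computable H \<and> computable K \<and>
      (\<forall>G. realizes G g \<longrightarrow> realizes (H \<circ>\<^sub>m (G \<circ>\<^sub>m K)) f))"

definition sW_equiv :: "('a, 'b) problem \<Rightarrow> ('c, 'd) problem \<Rightarrow> bool"
    (infix "\<equiv>\<^sub>s\<^sub>W" 50) where
  "f \<equiv>\<^sub>s\<^sub>W g \<longleftrightarrow> f \<le>\<^sub>s\<^sub>W g \<and> g \<le>\<^sub>s\<^sub>W f"

text \<open>The \<open>i\<close>-th component of \<open>p = \<langle>p\<^sub>0, p\<^sub>1, \<dots>\<rangle>\<close> is \<open>\<lambda>k. p (prod_encode (i, k))\<close>. Limits are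
  taken in the discrete topology of \<open>nat\<close>.\<close>

definition baire_lim :: "baire \<Rightarrow> baire option" where
  "baire_lim p =
    (if \<forall>k. convergent (\<lambda>i. p (prod_encode (i, k)))
     then Some (\<lambda>k. lim (\<lambda>i. p (prod_encode (i, k)))) else None)"

lemma baire_lim_iff:
  "baire_lim p = Some q \<longleftrightarrow> (\<forall>k. \<exists>N. \<forall>i\<ge>N. p (prod_encode (i, k)) = q k)"
proof -
  have "baire_lim p = Some q \<longleftrightarrow> (\<forall>k. (\<lambda>i. p (prod_encode (i, k))) \<longlonglongrightarrow> q k)"
    unfolding baire_lim_def
    by (auto simp: fun_eq_iff convergent_LIMSEQ_iff limI) (metis limI)
  then show ?thesis by (simp add: tendsto_discrete eventually_sequentially)
qed

definition jump :: "('a, 'b) problem \<Rightarrow> ('a, 'b) problem" where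
  "jump P = P\<lparr>in_rep := in_rep P \<circ>\<^sub>m baire_lim\<rparr>"


section \<open>Representations\<close>

text \<open>The discrete space \<open>{0, \<dots>, k - 1}\<close>.\<close>

definition fin_rep :: "nat \<Rightarrow> nat representation" where
  "fin_rep k p = (if p 0 < k then Some (p 0) else None)"

definition binary_rep :: "baire representation" where
  "binary_rep p = (if range p \<subseteq> {0, 1} then Some p else None)"

text \<open>Subsets of \<open>{0, 1}\<close> by enumeration of the complement: \<open>Suc a\<close> enumerates \<open>a\<close>, while \<open>0\<close>
  enumerates nothing (so that the empty complement can be enumerated).\<close>

definition neg_rep2 :: "nat set representation" where
  "neg_rep2 p =
    (if {a. Suc a \<in> range p} \<subseteq> {0, 1} then Some ({0, 1} - {a. Suc a \<in> range p}) else None)"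

definition set_rep :: "nat set representation" where
  "set_rep p = (if range p \<subseteq> {0, 1} then Some {n. p n = 1} else None)"

text \<open>The pair \<open>r = \<langle>p, q\<rangle>\<close> is given by \<open>r (2 * n) = p n\<close> and \<open>r (2 * n + 1) = q n\<close>.\<close>

definition prod_rep :: "'a representation \<Rightarrow> 'b representation \<Rightarrow> ('a \<times> 'b) representation" where
  "prod_rep \<delta> \<epsilon> r =
    (case (\<delta> (\<lambda>n. r (2 * n)), \<epsilon> (\<lambda>n. r (2 * n + 1))) of
       (Some x, Some y) \<Rightarrow> Some (x, y) | _ \<Rightarrow> None)"

text \<open>\<open>theta n \<langle>i\<^sub>0, \<dots>, i\<^sub>n\<^sub>-\<^sub>1\<rangle>\<close> is the set of the numbers \<open>k + i\<^sub>0 + \<dots> + i\<^sub>k\<close> for \<open>k < n\<close>, where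
  \<open>\<langle>i\<^sub>0, \<dots>, i\<^sub>n\<^sub>-\<^sub>1\<rangle>\<close> is Cantor's pairing iterated to the right. Only \<open>n \<ge> 1\<close> is meaningful.\<close>

fun theta :: "nat \<Rightarrow> nat \<Rightarrow> nat set" where
  "theta 0 x = {}"
| "theta (Suc 0) x = {x}"
| "theta (Suc (Suc n)) x =
    (case prod_decode x of (i, y) \<Rightarrow> insert i ((\<lambda>m. Suc (i + m)) ` theta (Suc n) y))"

definition coloring_rep :: "nat \<Rightarrow> nat \<Rightarrow> (nat set \<Rightarrow> nat) representation" where
  "coloring_rep n k p =
    (if range p \<subseteq> {..<k}
     then Some (\<lambda>A\<in>[UNIV]\<^bsup>n\<^esup>. p (inv (theta n) A)) else None)"


section \<open>The problems\<close>

definition C2 :: "(nat set, nat) problem" where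
  "C2 = \<lparr>in_rep = neg_rep2, out_rep = fin_rep 2, mmap = (\<lambda>A. {a. A \<subseteq> {0, 1} \<and> a \<in> A})\<rparr>"

definition BWT2 :: "(nat \<Rightarrow> nat, nat) problem" where
  "BWT2 = \<lparr>in_rep = binary_rep, out_rep = fin_rep 2,
    mmap = (\<lambda>x. {a. range x \<subseteq> {0, 1} \<and> infinite {i. x i = a}})\<rparr>"

definition colorings :: "nat \<Rightarrow> nat \<Rightarrow> (nat set \<Rightarrow> nat) set" where
  "colorings n k = [UNIV]\<^bsup>n\<^esup> \<rightarrow>\<^sub>E {..<k}"

definition homogeneous :: "nat \<Rightarrow> (nat set \<Rightarrow> nat) \<Rightarrow> nat set \<Rightarrow> bool" where
  "homogeneous n c M \<longleftrightarrow> (\<exists>j. \<forall>A\<in>[M]\<^bsup>n\<^esup>. c A = j)"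

definition hom_color :: "nat \<Rightarrow> (nat set \<Rightarrow> nat) \<Rightarrow> nat set \<Rightarrow> nat" where
  "hom_color n c M = (THE j. \<forall>A\<in>[M]\<^bsup>n\<^esup>. c A = j)"

text \<open>For \<open>i \<in> A\<close> the set \<open>A \<union> {i}\<close> is not in the domain of \<open>c\<close>, but this concerns only finitely
  many \<open>i\<close>.\<close>

definition stable :: "nat \<Rightarrow> (nat set \<Rightarrow> nat) \<Rightarrow> bool" where
  "stable n c \<longleftrightarrow> (\<forall>A\<in>nsets UNIV (n - 1). convergent (\<lambda>i. c (A \<union> {i})))"

definition CSRT :: "nat \<Rightarrow> nat \<Rightarrow> (nat set \<Rightarrow> nat, nat \<times> nat set) problem" where
  "CSRT n k = \<lparr>in_rep = coloring_rep n k, out_rep = prod_rep (fin_rep k) set_rep,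
    mmap = (\<lambda>c. {(hom_color n c M, M) | M.
      c \<in> colorings n k \<and> stable n c \<and> infinite M \<and> homogeneous n c M})\<rparr>"


section \<open>Adequacy of the representations\<close>

lemma bij_theta:
  assumes "n \<ge> 1"
  shows "bij_betw (theta n) UNIV ([UNIV]\<^bsup>n\<^esup>)"
  using assms
proof (induction n rule: dec_induct)
  case base
  have "inj (theta 1)" by (auto simp: inj_def)
  moreover have "range (theta 1) = [UNIV]\<^bsup>1\<^esup>"
    by (auto simp: nsets_def card_1_singleton_iff)
  ultimately show ?case by (simp add: bij_betw_def)
next
  case (step n)
  obtain m where n: "n = Suc m" using step.hyps by (cases n) auto
  define sh where "sh i = (\<lambda>k. Suc (i + k))" for i :: nat
  have sh: "inj (sh i)" for i by (auto simp: sh_def inj_def)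
  have th: "theta (Suc n) x = insert (fst (prod_decode x))
      (sh (fst (prod_decode x)) ` theta n (snd (prod_decode x)))" for x
    by (simp add: n sh_def split: prod.split)
  have inj_n: "inj (theta n)" and ran_n: "range (theta n) = [UNIV]\<^bsup>n\<^esup>"
    using step.IH by (auto simp: bij_betw_def)
  have "theta n y \<in> [UNIV]\<^bsup>n\<^esup>" for y
    unfolding ran_n[symmetric] by (rule rangeI)
  then have fin: "finite (theta n y)" "card (theta n y) = n" for y
    by (simp_all add: nsets_def)
  have Min: "(LEAST j. j \<in> insert i (sh i ` B)) = i" for i B
    by (rule Least_equality) (auto simp: sh_def)
  have notin: "i \<notin> sh i ` B" for i B by (auto simp: sh_def)
  have "inj (theta (Suc n))"
  proof (rule injI)
    fix x y assume eq: "theta (Suc n) x = theta (Suc n) y"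
    have f: "fst (prod_decode x) = fst (prod_decode y)"
      using arg_cong[OF eq, of "\<lambda>S. LEAST j. j \<in> S"] unfolding th Min .
    have "sh (fst (prod_decode x)) ` theta n (snd (prod_decode x))
        = sh (fst (prod_decode x)) ` theta n (snd (prod_decode y))"
      using eq unfolding th f insert_ident[OF notin notin] .
    then have "theta n (snd (prod_decode x)) = theta n (snd (prod_decode y))"
      unfolding inj_image_eq_iff[OF sh] .
    then have "snd (prod_decode x) = snd (prod_decode y)"
      by (rule injD[OF inj_n])
    with f have "prod_decode x = prod_decode y" by (rule prod_eqI)
    then show "x = y" by (rule injD[OF inj_prod_decode])
  qed
  moreover have "range (theta (Suc n)) = [UNIV]\<^bsup>Suc n\<^esup>"
  proof (intro equalityI subsetI)
    fix S assume "S \<in> range (theta (Suc n))"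
    then obtain x where "S = theta (Suc n) x" by auto
    moreover have "card (sh (fst (prod_decode x)) ` theta n (snd (prod_decode x))) = n"
      using fin sh by (simp add: card_image inj_on_subset[OF sh])
    ultimately show "S \<in> [UNIV]\<^bsup>Suc n\<^esup>"
      using fin notin by (simp add: th nsets_def)
  next
    fix S :: "nat set" assume "S \<in> [UNIV]\<^bsup>Suc n\<^esup>"
    then have S: "finite S" "card S = Suc n" "S \<noteq> {}" by (auto simp: nsets_def)
    define i where "i = Min S"
    have i: "i \<in> S" "\<And>j. j \<in> S \<Longrightarrow> i \<le> j" using S by (auto simp: i_def)
    define B where "B = (\<lambda>j. j - Suc i) ` (S - {i})"
    have shB: "sh i ` B = S - {i}"
    proof -
      have "sh i (j - Suc i) = j" if "j \<in> S - {i}" for j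
        using that i(2)[of j] by (auto simp: sh_def)
      then show ?thesis unfolding B_def image_image by simp
    qed
    have "card B = n"
      using S i shB card_image[OF inj_on_subset[OF sh[of i]], of B] by simp
    moreover have "finite B" using S by (simp add: B_def)
    ultimately have "B \<in> range (theta n)" unfolding ran_n by (simp add: nsets_def)
    then obtain y where "B = theta n y" by auto
    then have "S = theta (Suc n) (prod_encode (i, y))"
      using i shB by (auto simp: th)
    then show "S \<in> range (theta (Suc n))" by blast
  qed
  ultimately show ?case by (simp add: bij_betw_def)
qed

lemma coloring_rep_iff:
  assumes "n \<ge> 1"
  shows "coloring_rep n k p = Some c \<longleftrightarrow> c \<in> colorings n k \<and> (\<forall>i. p i = c (theta n i))"
proof -
  have inj: "inj (theta n)" and ran: "range (theta n) = [UNIV]\<^bsup>n\<^esup>"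
    using bij_theta[OF assms] by (auto simp: bij_betw_def)
  have mem: "theta n i \<in> [UNIV]\<^bsup>n\<^esup>" for i using ran by auto
  show ?thesis
  proof
    assume "coloring_rep n k p = Some c"
    then have "range p \<subseteq> {..<k}" and c: "c = (\<lambda>A\<in>[UNIV]\<^bsup>n\<^esup>. p (inv (theta n) A))"
      by (auto simp: coloring_rep_def split: if_splits)
    then show "c \<in> colorings n k \<and> (\<forall>i. p i = c (theta n i))"
      using mem inj by (auto simp: colorings_def)
  next
    assume c: "c \<in> colorings n k \<and> (\<forall>i. p i = c (theta n i))"
    then have "range p \<subseteq> {..<k}" using mem by (fastforce simp: colorings_def)
    moreover have "c = (\<lambda>A\<in>[UNIV]\<^bsup>n\<^esup>. p (inv (theta n) A))"
    proof (rule ext)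
      fix A show "c A = (\<lambda>A\<in>[UNIV]\<^bsup>n\<^esup>. p (inv (theta n) A)) A"
      proof (cases "A \<in> [UNIV]\<^bsup>n\<^esup>")
        case True
        then show ?thesis using c ran by (simp add: f_inv_into_f)
      next
        case False
        have "c A = undefined"
          using c False PiE_arb unfolding colorings_def by metis
        then show ?thesis using False by simp
      qed
    qed
    ultimately show "coloring_rep n k p = Some c" by (simp add: coloring_rep_def)
  qed
qed

lemma carriers:
  "ran neg_rep2 = Pow {0, 1}"
  "ran binary_rep = {x. range x \<subseteq> {0, 1}}"
  "ran (fin_rep k) = {..<k}"
  "ran set_rep = UNIV"
  "n \<ge> 1 \<Longrightarrow> ran (coloring_rep n k) = colorings n k"
proof -
  have "A \<in> ran neg_rep2" if "A \<subseteq> {0, 1}" for A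
  proof -
    define p where "p m = (if m \<in> Suc ` ({0, 1} - A) then m else 0)" for m
    have "{a. Suc a \<in> range p} = {0, 1} - A"
      by (auto simp: p_def image_iff split: if_splits)
    then have "neg_rep2 p = Some A"
      using that unfolding neg_rep2_def by auto
    then show ?thesis unfolding ran_def by blast
  qed
  then show "ran neg_rep2 = Pow {0, 1}"
    by (fastforce simp: neg_rep2_def ran_def split: if_splits)
  show "ran binary_rep = {x. range x \<subseteq> {0, 1}}"
    by (auto simp: binary_rep_def ran_def split: if_splits)
  show "ran (fin_rep k) = {..<k}"
    unfolding fin_rep_def ran_def by force
  have "set_rep (\<lambda>n. if n \<in> A then 1 else 0) = Some A" for A
    by (auto simp: set_rep_def)
  then show "ran set_rep = UNIV" unfolding ran_def by blast
  show "ran (coloring_rep n k) = colorings n k" if "n \<ge> 1"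
  proof (intro equalityI subsetI)
    fix c assume "c \<in> ran (coloring_rep n k)"
    then obtain p where "coloring_rep n k p = Some c" unfolding ran_def by blast
    then show "c \<in> colorings n k" unfolding coloring_rep_iff[OF that] by (rule conjunct1)
  next
    fix c assume "c \<in> colorings n k"
    then have "coloring_rep n k (\<lambda>i. c (theta n i)) = Some c"
      unfolding coloring_rep_iff[OF that] by simp
    then show "c \<in> ran (coloring_rep n k)" unfolding ran_def by blast
  qed
qed

end

theory Submission imports Defs begin

text \<open>A reduction whose inner functional \<open>K\<close> is total lifts to jumps by applying \<open>K\<close> to every row
  of the input, since a computation that halts reads only finitely many oracle values. So
  \<open>BWT\<^sub>2\<close> need only be compared with the first jump of \<open>C\<^sub>2\<close>. An input of \<open>BWT\<^sub>2\<^bsup>(n-1)\<^esup>\<close> is a function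
  \<open>p\<close> whose iterated limit is a binary sequence \<open>x\<close>. Colour \<open>a\<^sub>0 < \<dots> < a\<^sub>m\<close> (with \<open>m = n - 1\<close>) by the
  approximation \<open>p \<langle>a\<^sub>m, \<langle>\<dots>, \<langle>a\<^sub>1, a\<^sub>0\<rangle>\<rangle>\<rangle>\<close> to \<open>x a\<^sub>0\<close>, cut off at \<open>1\<close>. This colouring is stable because the
  outermost limit exists. Taking all the limits along an infinite homogeneous set shows that \<open>x\<close> is
  constant on it, and its colour is the value of \<open>x\<close> there.\<close>

section \<open>Relative computability\<close>

text \<open>Replaces the oracle by the program \<open>r\<close>, which receives a parameter appended to the arguments
  as its second argument. The last argument is the arity of the program, which determines the
  position of the parameter.\<close>

fun subst_oracle :: "recf \<Rightarrow> recf \<Rightarrow> nat \<Rightarrow> recf" where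
  "subst_oracle r Zero a = Zero"
| "subst_oracle r Succ a = Comp Succ [Proj 0]"
| "subst_oracle r (Proj j) a = Proj j"
| "subst_oracle r Oracle a = r"
| "subst_oracle r (Comp f gs) a =
    Comp (subst_oracle r f (length gs)) (map (\<lambda>g. subst_oracle r g a) gs @ [Proj a])"
| "subst_oracle r (PrimRec f g) a =
    PrimRec (subst_oracle r f (a - 1)) (subst_oracle r g (Suc a))"
| "subst_oracle r (Mu f) a = Mu (subst_oracle r f (Suc a))"

text \<open>Appending the parameter keeps every index of \<open>Proj\<close> valid, since recursion
  and minimisation put their variables in front. \<open>Comp\<close> hands the parameter on as one
  further argument. Only this implication can be expected: a \<open>Proj\<close> that is out of
  range with oracle \<open>q\<close> may hit the parameter after the substitution.\<close>

lemma eval_subst_oracle: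
  assumes r: "\<And>k. eval p r [k, i] (q k)"
  shows "eval q e xs y \<Longrightarrow> eval p (subst_oracle r e (length xs)) (xs @ [i]) y"
proof (induction rule: eval.induct)
  case (eval_Zero xs)
  show ?case by (simp add: eval.eval_Zero)
next
  case (eval_Succ x)
  have "eval p (Proj 0) [x, i] ([x, i] ! 0)" by (rule eval.eval_Proj) simp
  then have "list_all2 (\<lambda>g y. eval p g [x, i] y) [Proj 0] [x]" by simp
  then show ?case by (simp add: eval.eval_Comp[OF _ eval.eval_Succ])
next
  case (eval_Proj j xs)
  then have "eval p (Proj j) (xs @ [i]) ((xs @ [i]) ! j)" by (intro eval.eval_Proj) simp
  with eval_Proj show ?case by (simp add: nth_append)
next
  case (eval_Oracle x)
  show ?case by (simp add: r)
next
  case (eval_Comp xs gs ys f z)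
  have len: "length gs = length ys" using eval_Comp.IH(1) by (rule list_all2_lengthD)
  have "eval p (Proj (length xs)) (xs @ [i]) ((xs @ [i]) ! length xs)"
    by (rule eval.eval_Proj) simp
  then have par: "eval p (Proj (length xs)) (xs @ [i]) i" by simp
  have "list_all2 (\<lambda>g. eval p g (xs @ [i]))
      (map (\<lambda>g. subst_oracle r g (length xs)) gs) ys"
    using eval_Comp.IH(1) by (auto simp: list_all2_conv_all_nth)
  then have "list_all2 (\<lambda>g. eval p g (xs @ [i]))
      (map (\<lambda>g. subst_oracle r g (length xs)) gs @ [Proj (length xs)]) (ys @ [i])"
    using par by (simp add: list_all2_appendI)
  with eval_Comp.IH(2) len show ?case by (auto intro: eval.eval_Comp)
next
  case (eval_PrimRec_0 f xs y g)
  then show ?case by (simp add: eval.eval_PrimRec_0)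
next
  case (eval_PrimRec_Suc f g n xs y z)
  then show ?case by (auto intro: eval.eval_PrimRec_Suc)
next
  case (eval_Mu f n xs)
  then show ?case by (auto intro!: eval.eval_Mu)
qed

text \<open>A halting run consults finitely many oracle values, and finitely many properties that
  each hold eventually hold together eventually. For \<open>Mu\<close> these are the values at the
  finitely many candidates up to \<open>n\<close>.\<close>

lemma eventually_eval:
  assumes s: "\<And>k. eventually (\<lambda>i. s i k = p k) F"
  shows "eval p e xs y \<Longrightarrow> eventually (\<lambda>i. eval (s i) e xs y) F"
proof (induction rule: eval.induct)
  case (eval_Zero xs)
  show ?case by (simp add: eval.eval_Zero)
next
  case (eval_Succ x)
  show ?case by (simp add: eval.eval_Succ)
next
  case (eval_Proj i xs)
  then show ?case by (simp add: eval.eval_Proj)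
next
  case (eval_Oracle x)
  show ?case using s[of x] by (rule eventually_mono) (metis eval.eval_Oracle)
next
  case (eval_Comp xs gs ys f z)
  have len: "length gs = length ys" using eval_Comp.IH(1) by (rule list_all2_lengthD)
  have "\<forall>j\<in>{..<length gs}. eventually (\<lambda>i. eval (s i) (gs ! j) xs (ys ! j)) F"
    using eval_Comp.IH(1) by (auto simp: list_all2_conv_all_nth)
  then have "eventually (\<lambda>i. \<forall>j\<in>{..<length gs}. eval (s i) (gs ! j) xs (ys ! j)) F"
    by (rule eventually_ball_finite[OF finite_lessThan])
  with eval_Comp.IH(2) show ?case
    by eventually_elim (rule eval.eval_Comp[where ys = ys],
      simp_all add: list_all2_conv_all_nth len)
next
  case (eval_PrimRec_0 f xs y g)
  from eval_PrimRec_0.IH show ?case by eventually_elim (rule eval.eval_PrimRec_0)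
next
  case (eval_PrimRec_Suc f g n xs y z)
  from eval_PrimRec_Suc.IH show ?case by eventually_elim (rule eval.eval_PrimRec_Suc)
next
  case (eval_Mu f n xs)
  have "\<forall>m\<in>{..<n}. eventually (\<lambda>i. \<exists>y. eval (s i) f (m # xs) (Suc y)) F"
    using eval_Mu.IH(2) by (blast intro: eventually_mono)
  then have "eventually (\<lambda>i. \<forall>m\<in>{..<n}. \<exists>y. eval (s i) f (m # xs) (Suc y)) F"
    by (rule eventually_ball_finite[OF finite_lessThan])
  with eval_Mu.IH(1) show ?case by eventually_elim (auto intro: eval.eval_Mu)
qed

lemma computable_map_comp:
  assumes "computable F" "computable G"
  shows "computable (F \<circ>\<^sub>m G)"
proof -
  obtain f g where f: "\<And>p q n. F p = Some q \<Longrightarrow> eval p f [n] (q n)"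
    and g: "\<And>p q n. G p = Some q \<Longrightarrow> eval p g [n] (q n)"
    using assms unfolding computable_def by metis
  \<comment> \<open>\<open>g\<close> takes one argument, so \<open>r\<close> forwards the position
    alone; the program below fills the parameter slot with \<open>0\<close>.\<close>
  define r where "r = Comp g [Proj 0]"
  have "eval p (Comp (subst_oracle r f 1) [Proj 0, Zero]) [n] (q n)"
    if "(F \<circ>\<^sub>m G) p = Some q" for p q n
  proof -
    obtain u where u: "G p = Some u" "F u = Some q"
      using \<open>(F \<circ>\<^sub>m G) p = Some q\<close> by (auto simp: map_comp_def split: option.splits)
    have hd: "eval p (Proj 0) (x # xs) x" for x xs
      using eval.eval_Proj[of 0 "x # xs" p] by simp
    have "eval p r [k, 0] (u k)" for k
      unfolding r_def by (rule eval.eval_Comp[OF _ g[OF u(1)]]) (simp add: hd)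
    then have "eval p (subst_oracle r f (length [n])) ([n] @ [0]) (q n)"
      using f[OF u(2)] by (rule eval_subst_oracle)
    then show ?thesis
      by (intro eval.eval_Comp[of p _ _ "[n, 0]"]) (simp_all add: hd eval.eval_Zero)
  qed
  then show ?thesis unfolding computable_def by blast
qed

section \<open>Total functionals\<close>

text \<open>Speaking of values instead of programs lets closure rules certify a concrete formula
  syntactically. Totality keeps halting conditions out of these rules, except for unbounded
  search.\<close>

definition functional :: "nat \<Rightarrow> (baire \<Rightarrow> nat list \<Rightarrow> nat) \<Rightarrow> bool" where
  "functional a F \<longleftrightarrow> (\<exists>e. \<forall>p xs. length xs = a \<longrightarrow> eval p e xs (F p xs))"

lemma functional_cong:
  assumes "functional a F" "\<And>p xs. length xs = a \<Longrightarrow> F p xs = G p xs"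
  shows "functional a G"
  using assms unfolding functional_def by metis

lemma functional_nth: "i < a \<Longrightarrow> functional a (\<lambda>p xs. xs ! i)"
  unfolding functional_def by (auto intro: eval.eval_Proj)

lemma functional_comp1:
  assumes "functional 1 F" "functional a G"
  shows "functional a (\<lambda>p xs. F p [G p xs])"
proof -
  obtain f g where fg: "\<And>p xs. length xs = 1 \<Longrightarrow> eval p f xs (F p xs)"
    "\<And>p xs. length xs = a \<Longrightarrow> eval p g xs (G p xs)"
    using assms unfolding functional_def by metis
  have "eval p (Comp f [g]) xs (F p [G p xs])" if "length xs = a" for p xs
    by (rule eval.eval_Comp[where ys = "[G p xs]"]) (simp_all add: fg that)
  then show ?thesis unfolding functional_def by blast
qed

lemma functional_comp3:
  assumes "functional 3 F" "functional a G1" "functional a G2" "functional a G3"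
  shows "functional a (\<lambda>p xs. F p [G1 p xs, G2 p xs, G3 p xs])"
proof -
  obtain f g1 g2 g3 where fg: "\<And>p xs. length xs = 3 \<Longrightarrow> eval p f xs (F p xs)"
    "\<And>p xs. length xs = a \<Longrightarrow> eval p g1 xs (G1 p xs)"
    "\<And>p xs. length xs = a \<Longrightarrow> eval p g2 xs (G2 p xs)"
    "\<And>p xs. length xs = a \<Longrightarrow> eval p g3 xs (G3 p xs)"
    using assms unfolding functional_def by metis
  have "eval p (Comp f [g1, g2, g3]) xs (F p [G1 p xs, G2 p xs, G3 p xs])"
    if "length xs = a" for p xs
    by (rule eval.eval_Comp[where ys = "[G1 p xs, G2 p xs, G3 p xs]"]) (simp_all add: fg that)
  then show ?thesis unfolding functional_def by blast
qed

lemma functional_Suc: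
  assumes "functional a F"
  shows "functional a (\<lambda>p xs. Suc (F p xs))"
proof -
  have "functional 1 (\<lambda>p xs. Suc (xs ! 0))"
    unfolding functional_def
    by (rule exI[of _ Succ]) (auto simp: length_Suc_conv intro: eval.eval_Succ)
  from functional_comp1[OF this assms] show ?thesis by simp
qed

lemma functional_oracle:
  assumes "functional a F"
  shows "functional a (\<lambda>p xs. p (F p xs))"
proof -
  have "functional 1 (\<lambda>p xs. p (xs ! 0))"
    unfolding functional_def
    by (rule exI[of _ Oracle]) (auto simp: length_Suc_conv intro: eval.eval_Oracle)
  from functional_comp1[OF this assms] show ?thesis by simp
qed

lemma functional_const: "functional a (\<lambda>p xs. c)"
proof (induction c)
  case 0
  show ?case unfolding functional_def by (auto intro: eval.eval_Zero)
qed (rule functional_Suc)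

text \<open>Supplies a subprogram with the arguments behind a prefix: the empty prefix passes all of
  them on, a prefix of length 2 drops the counter and the previous value of a recursion.\<close>

lemma eval_Projs:
  "list_all2 (\<lambda>g. eval p g (us @ xs)) (map (\<lambda>i. Proj (length us + i)) [0..<length xs]) xs"
proof -
  have "eval p (Proj (length us + i)) (us @ xs) (xs ! i)" if "i < length xs" for i
    using eval.eval_Proj[of "length us + i" "us @ xs" p] that by simp
  then show ?thesis by (simp add: list_all2_conv_all_nth)
qed

lemma functional_rec:
  assumes F: "functional a F" and G: "functional (Suc (Suc a)) G" and N: "functional a N"
  shows "functional a (\<lambda>p xs. rec_nat (F p xs) (\<lambda>n y. G p (n # y # xs)) (N p xs))"
proof -
  obtain f g k where f: "\<And>p xs. length xs = a \<Longrightarrow> eval p f xs (F p xs)"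
    and g: "\<And>p xs. length xs = Suc (Suc a) \<Longrightarrow> eval p g xs (G p xs)"
    and k: "\<And>p xs. length xs = a \<Longrightarrow> eval p k xs (N p xs)"
    using assms unfolding functional_def by metis
  have rec: "eval p (PrimRec f g) (n # xs) (rec_nat (F p xs) (\<lambda>n y. G p (n # y # xs)) n)"
    if "length xs = a" for p xs n
  proof (induction n)
    case 0
    show ?case using f[OF that] by (auto intro: eval.eval_PrimRec_0)
  next
    case (Suc n)
    from eval.eval_PrimRec_Suc[OF this g] that show ?case by simp
  qed
  have "eval p (Comp (PrimRec f g) (k # map Proj [0..<a])) xs
      (rec_nat (F p xs) (\<lambda>n y. G p (n # y # xs)) (N p xs))" if "length xs = a" for p xs
    by (rule eval.eval_Comp[OF _ rec[OF that]])
      (use eval_Projs[of p "[]" xs] that k in simp)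
  then show ?thesis unfolding functional_def by blast
qed

lemma functional_Least:
  assumes G: "functional (Suc a) G" and ex: "\<And>p xs. length xs = a \<Longrightarrow> \<exists>n. G p (n # xs) = 0"
  shows "functional a (\<lambda>p xs. LEAST n. G p (n # xs) = 0)"
proof -
  obtain g where g: "\<And>p xs. length xs = Suc a \<Longrightarrow> eval p g xs (G p xs)"
    using G unfolding functional_def by metis
  have "eval p (Mu g) xs (LEAST n. G p (n # xs) = 0)" if len: "length xs = a" for p xs
  proof (rule eval.eval_Mu)
    have g': "eval p g (n # xs) (G p (n # xs))" for n using g len by simp
    have "G p ((LEAST n. G p (n # xs) = 0) # xs) = 0" by (rule LeastI_ex[OF ex[OF len]])
    then show "eval p g ((LEAST n. G p (n # xs) = 0) # xs) 0" using g' by metis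
    show "\<forall>m<LEAST n. G p (n # xs) = 0. \<exists>y. eval p g (m # xs) (Suc y)"
      using g' not_less_Least not0_implies_Suc by metis
  qed
  then show ?thesis unfolding functional_def by blast
qed

lemma functional_weaken:
  assumes F: "functional a F"
  shows "functional (Suc (Suc a)) (\<lambda>p xs. F p (tl (tl xs)))"
proof -
  obtain f where f: "\<And>p xs. length xs = a \<Longrightarrow> eval p f xs (F p xs)"
    using F unfolding functional_def by metis
  have "eval p (Comp f (map (\<lambda>i. Proj (Suc (Suc i))) [0..<a])) xs (F p (tl (tl xs)))"
    if len: "length xs = Suc (Suc a)" for p xs
  proof -
    obtain u v ws where xs: "xs = [u, v] @ ws" "length ws = a"
      using len by (auto simp: length_Suc_conv)
    show ?thesis
      by (rule eval.eval_Comp[where ys = ws]) (use eval_Projs[of p "[u, v]" ws] xs f in simp_all)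
  qed
  then show ?thesis unfolding functional_def by blast
qed

section \<open>Arithmetic, case distinctions, bounded sums and pairing\<close>

lemma functional_add:
  assumes "functional a F" "functional a G"
  shows "functional a (\<lambda>p xs. F p xs + G p xs)"
proof -
  have "rec_nat m (\<lambda>n y. Suc y) n = m + n" for m n :: nat by (induction n) auto
  then show ?thesis
    using functional_rec[OF assms(1) functional_Suc[OF functional_nth[of 1]] assms(2)] by simp
qed

lemma functional_diff:
  assumes "functional a F" "functional a G"
  shows "functional a (\<lambda>p xs. F p xs - G p xs)"
proof -
  have "rec_nat 0 (\<lambda>n y. n) n = n - 1" for n :: nat by (induction n) auto
  then have pred: "functional 1 (\<lambda>p xs. xs ! 0 - 1)"
    using functional_rec[OF functional_const[of 1 0] functional_nth[of 0] functional_nth[of 0 1]]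
    by simp
  have "rec_nat m (\<lambda>n y. y - 1) n = m - n" for m n :: nat by (induction n) auto
  then show ?thesis
    using functional_rec[OF assms(1) functional_comp1[OF pred functional_nth[of 1]] assms(2)]
    by simp
qed

text \<open>A recursion that starts with \<open>A\<close> and whose step returns \<open>B\<close>,
  whatever the counter and the previous value are.\<close>

lemma functional_if_0:
  assumes "functional a F" "functional a A" "functional a B"
  shows "functional a (\<lambda>p xs. if F p xs = 0 then A p xs else B p xs)"
proof -
  have "rec_nat m (\<lambda>n y. k) n = (if n = 0 then m else k)" for m n k :: nat by (cases n) auto
  then show ?thesis
    using functional_rec[OF assms(2) functional_weaken[OF assms(3)] assms(1)] by simp
qed

lemma functional_if_le:
  assumes "functional a F" "functional a G" "functional a A" "functional a B"
  shows "functional a (\<lambda>p xs. if F p xs \<le> G p xs then A p xs else B p xs)"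
  using functional_if_0[OF functional_diff[OF assms(1,2)] assms(3,4)] by simp

lemma functional_if_eq:
  assumes "functional a F" "functional a G" "functional a A" "functional a B"
  shows "functional a (\<lambda>p xs. if F p xs = G p xs then A p xs else B p xs)"
  using functional_if_le[OF assms(1,2) functional_if_le[OF assms(2,1,3,4)] assms(4)]
  by (rule functional_cong) auto

lemma functional_sum:
  assumes G: "functional (Suc a) G" and N: "functional a N"
  shows "functional a (\<lambda>p xs. \<Sum>j<N p xs. G p (j # xs))"
proof -
  obtain g where g: "\<And>p xs. length xs = Suc a \<Longrightarrow> eval p g xs (G p xs)"
    using G unfolding functional_def by metis
  \<comment> \<open>The recursion step receives \<open>j # y # xs\<close>; this program removes the
    accumulator \<open>y\<close> before \<open>g\<close> is run.\<close>
  have "eval p (Comp g (Proj 0 # map (\<lambda>i. Proj (Suc (Suc i))) [0..<a])) xs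
      (G p (hd xs # tl (tl xs)))" if len: "length xs = Suc (Suc a)" for p xs
  proof -
    obtain u v ws where xs: "xs = [u, v] @ ws" "length ws = a"
      using len by (auto simp: length_Suc_conv)
    have "eval p (Proj 0) xs u" using eval.eval_Proj[of 0 xs p] xs by simp
    then show ?thesis
      by (intro eval.eval_Comp[where ys = "u # ws"])
        (use eval_Projs[of p "[u, v]" ws] xs g in simp_all)
  qed
  then have "functional (Suc (Suc a)) (\<lambda>p xs. G p (hd xs # tl (tl xs)))"
    unfolding functional_def by blast
  from functional_rec[OF functional_const[of a 0] functional_add[OF functional_nth[of 1] this] N]
  have "functional a (\<lambda>p xs. rec_nat 0 (\<lambda>n y. y + G p (n # xs)) (N p xs))" by simp
  moreover have "rec_nat 0 (\<lambda>n y. y + h n) n = sum h {..<n}" for h :: "nat \<Rightarrow> nat" and n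
    by (induction n) auto
  ultimately show ?thesis by simp
qed

lemma functional_triangle:
  assumes "functional a F"
  shows "functional a (\<lambda>p xs. triangle (F p xs))"
proof -
  have "rec_nat 0 (\<lambda>n y. y + Suc n) n = triangle n" for n by (induction n) auto
  then show ?thesis
    using functional_rec[OF functional_const[of a 0]
        functional_add[OF functional_nth[of 1] functional_Suc[OF functional_nth[of 0]]] assms]
    by simp
qed

lemma functional_prod_encode:
  assumes "functional a F" "functional a G"
  shows "functional a (\<lambda>p xs. prod_encode (F p xs, G p xs))"
  unfolding prod_encode_def prod.case
  by (intro functional_add functional_triangle assms)

text \<open>The code is \<open>triangle (i + k) + i\<close>, which lies in the block from
  \<open>triangle (i + k)\<close> up to, but excluding, \<open>triangle (Suc (i + k))\<close>. With
  truncated subtraction, the equation says that the code is below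
  \<open>triangle (Suc s)\<close>.\<close>

lemma Least_triangle: "(LEAST s. Suc (prod_encode (i, k)) - triangle (Suc s) = 0) = i + k"
proof (rule Least_equality)
  fix s assume "Suc (prod_encode (i, k)) - triangle (Suc s) = 0"
  then have "triangle (i + k) < triangle (Suc s)" by (simp add: prod_encode_def)
  moreover have "mono triangle" by (rule mono_iff_le_Suc[THEN iffD2]) simp
  ultimately show "i + k \<le> s" by (meson monoD not_le Suc_leI)
qed (simp add: prod_encode_def)

text \<open>Once the search has found the diagonal \<open>i + k\<close>, the first component is the
  distance of the code from \<open>triangle (i + k)\<close>, and the second is what remains of the
  diagonal.\<close>

lemma functional_prod_decode:
  assumes "functional a F"
  shows "functional a (\<lambda>p xs. fst (prod_decode (F p xs)))"
    and "functional a (\<lambda>p xs. snd (prod_decode (F p xs)))"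
proof -
  define s where "s t = (LEAST s. Suc t - triangle (Suc s) = 0)" for t
  \<comment> \<open>Makes the search total: the code itself is a witness.\<close>
  have tri: "t \<le> triangle t" for t by (induction t) auto
  have "functional 1 (\<lambda>p xs. LEAST n. (\<lambda>p xs. Suc (xs ! 1) - triangle (Suc (xs ! 0))) p (n # xs) = 0)"
  proof (rule functional_Least)
    show "functional (Suc 1) (\<lambda>p xs. Suc (xs ! 1) - triangle (Suc (xs ! 0)))"
      by (intro functional_diff functional_Suc functional_triangle functional_nth) auto
    show "\<exists>n. Suc ((n # xs) ! 1) - triangle (Suc ((n # xs) ! 0)) = 0" for xs
      using tri[of "Suc (xs ! 0)"] by (intro exI[of _ "xs ! 0"]) simp
  qed
  then have "functional 1 (\<lambda>p xs. s (xs ! 0))" by (simp add: s_def)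
  from functional_comp1[OF this assms] have s: "functional a (\<lambda>p xs. s (F p xs))" by simp
  have dec: "fst (prod_decode t) = t - triangle (s t)"
    "snd (prod_decode t) = s t - (t - triangle (s t))" for t
  proof -
    obtain i k where t: "t = prod_encode (i, k)" by (metis prod_decode_inverse surj_pair)
    have "s t = i + k" unfolding s_def t by (rule Least_triangle)
    moreover have "prod_decode t = (i, k)" by (simp add: t)
    moreover have "t = triangle (i + k) + i" by (simp add: t prod_encode_def)
    ultimately show "fst (prod_decode t) = t - triangle (s t)"
      "snd (prod_decode t) = s t - (t - triangle (s t))" by auto
  qed
  show "functional a (\<lambda>p xs. fst (prod_decode (F p xs)))"
    and "functional a (\<lambda>p xs. snd (prod_decode (F p xs)))"
    unfolding dec by (intro functional_diff functional_triangle s assms)+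
qed

lemmas functional_intros = functional_const functional_Suc functional_oracle functional_add
  functional_diff functional_if_eq functional_if_le functional_prod_encode functional_prod_decode

section \<open>Reductions with a total inner functional\<close>

definition total_computable :: "(baire \<Rightarrow> baire) \<Rightarrow> bool" where
  "total_computable K \<longleftrightarrow> (\<exists>e. \<forall>p n. eval p e [n] (K p n))"

lemma total_computable_functional:
  "functional 1 F \<Longrightarrow> (\<And>p n. F p [n] = K p n) \<Longrightarrow> total_computable K"
  unfolding functional_def total_computable_def by (metis One_nat_def length_Cons list.size(3))

text \<open>Realizers are eliminated: the condition concerns single names and single answers.
  \<open>K\<close> is required to be total because the rows of a name converging to \<open>p\<close>
  need not be names of admissible inputs themselves.\<close>

definition reduces_total :: "('a, 'b) problem \<Rightarrow> ('c, 'd) problem \<Rightarrow> bool" where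
  "reduces_total f g \<longleftrightarrow> (\<exists>H K. computable H \<and> total_computable K \<and>
    (\<forall>p x. in_rep f p = Some x \<and> mmap f x \<noteq> {} \<longrightarrow>
      (\<exists>z. in_rep g (K p) = Some z \<and> mmap g z \<noteq> {} \<and>
        (\<forall>q y. out_rep g q = Some y \<and> y \<in> mmap g z \<longrightarrow>
          (\<exists>q' y'. H q = Some q' \<and> out_rep f q' = Some y' \<and> y' \<in> mmap f x)))))"

lemma sW_le_if_reduces_total:
  assumes "reduces_total f g"
  shows "f \<le>\<^sub>s\<^sub>W g"
proof -
  obtain H K where H: "computable H" and K: "total_computable K"
    and HK: "\<And>p x. in_rep f p = Some x \<Longrightarrow> mmap f x \<noteq> {} \<Longrightarrow>
      \<exists>z. in_rep g (K p) = Some z \<and> mmap g z \<noteq> {} \<and>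
        (\<forall>q y. out_rep g q = Some y \<and> y \<in> mmap g z \<longrightarrow>
          (\<exists>q' y'. H q = Some q' \<and> out_rep f q' = Some y' \<and> y' \<in> mmap f x))"
    using assms unfolding reduces_total_def by auto
  have "computable (\<lambda>p. Some (K p))"
    using K unfolding computable_def total_computable_def by auto
  moreover have "realizes (H \<circ>\<^sub>m (G \<circ>\<^sub>m (\<lambda>p. Some (K p)))) f" if G: "realizes G g" for G
    unfolding realizes_def
  proof (intro allI impI, elim conjE)
    fix p x assume "in_rep f p = Some x" "mmap f x \<noteq> {}"
    from HK[OF this] obtain z where z: "in_rep g (K p) = Some z" "mmap g z \<noteq> {}"
      and zH: "\<And>q y. out_rep g q = Some y \<Longrightarrow> y \<in> mmap g z \<Longrightarrow>
          \<exists>q' y'. H q = Some q' \<and> out_rep f q' = Some y' \<and> y' \<in> mmap f x"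
      by blast
    obtain q y where "G (K p) = Some q" "out_rep g q = Some y" "y \<in> mmap g z"
      using G z unfolding realizes_def by blast
    then show "\<exists>q y. (H \<circ>\<^sub>m (G \<circ>\<^sub>m (\<lambda>p. Some (K p)))) p = Some q \<and> out_rep f q = Some y \<and>
        y \<in> mmap f x"
      using zH[of q y] by (auto simp: map_comp_def)
  qed
  ultimately show ?thesis using H unfolding sW_le_def by blast
qed

lemma sW_le_trans:
  assumes "f \<le>\<^sub>s\<^sub>W g" "g \<le>\<^sub>s\<^sub>W h"
  shows "f \<le>\<^sub>s\<^sub>W h"
proof -
  obtain H1 K1 H2 K2 where comp: "computable H1" "computable K1" "computable H2" "computable K2"
    and "\<And>G. realizes G g \<Longrightarrow> realizes (H1 \<circ>\<^sub>m (G \<circ>\<^sub>m K1)) f"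
    and "\<And>G. realizes G h \<Longrightarrow> realizes (H2 \<circ>\<^sub>m (G \<circ>\<^sub>m K2)) g"
    using assms unfolding sW_le_def by auto
  then have "realizes (H1 \<circ>\<^sub>m ((H2 \<circ>\<^sub>m (G \<circ>\<^sub>m K2)) \<circ>\<^sub>m K1)) f" if "realizes G h" for G
    using that by blast
  moreover have "H1 \<circ>\<^sub>m ((H2 \<circ>\<^sub>m (G \<circ>\<^sub>m K2)) \<circ>\<^sub>m K1) = (H1 \<circ>\<^sub>m H2) \<circ>\<^sub>m (G \<circ>\<^sub>m (K2 \<circ>\<^sub>m K1))" for G
    by (rule ext) (simp add: map_comp_def split: option.split)
  ultimately show ?thesis
    unfolding sW_le_def using computable_map_comp comp by metis
qed

section \<open>Lifting reductions to jumps\<close>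

lemma jump_simps:
  "in_rep (jump P) p = Some x \<longleftrightarrow> (\<exists>q. baire_lim p = Some q \<and> in_rep P q = Some x)"
  "out_rep (jump P) = out_rep P"
  "mmap (jump P) = mmap P"
  by (auto simp: jump_def map_comp_def split: option.splits)

text \<open>\<open>K'\<close> applies \<open>K\<close> to every row, and by continuity the results
  converge to \<open>K\<close> of the limit. \<open>H\<close> stays the same because a jump changes
  only the input representation.\<close>

lemma reduces_total_jump:
  assumes "reduces_total f g"
  shows "reduces_total (jump f) (jump g)"
proof -
  obtain H K where H: "computable H" and K: "total_computable K"
    and HK: "\<forall>p x. in_rep f p = Some x \<and> mmap f x \<noteq> {} \<longrightarrow>
      (\<exists>z. in_rep g (K p) = Some z \<and> mmap g z \<noteq> {} \<and>
        (\<forall>q y. out_rep g q = Some y \<and> y \<in> mmap g z \<longrightarrow>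
          (\<exists>q' y'. H q = Some q' \<and> out_rep f q' = Some y' \<and> y' \<in> mmap f x)))"
    using assms unfolding reduces_total_def by auto
  obtain e where e: "\<And>p n. eval p e [n] (K p n)" using K unfolding total_computable_def by blast
  define row :: "baire \<Rightarrow> nat \<Rightarrow> baire" where "row p i k = p (prod_encode (i, k))" for p i k
  define K' where "K' p t = K (row p (fst (prod_decode t))) (snd (prod_decode t))" for p t
  \<comment> \<open>\<open>subst_oracle\<close> calls \<open>r\<close> with the position first and
    the parameter, here the row index, second; hence the swapped order.\<close>
  have "functional 2 (\<lambda>p xs. p (prod_encode (xs ! 1, xs ! 0)))"
    by (intro functional_intros functional_nth) auto
  then obtain r where
    "\<And>p xs. length xs = 2 \<Longrightarrow> eval p r xs (p (prod_encode (xs ! 1, xs ! 0)))"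
    unfolding functional_def by blast
  from this[of "[_, _]"] have r: "eval p r [k, i] (row p i k)" for p k i
    by (simp add: row_def)
  obtain d0 d1 where "\<And>p xs. length xs = 1 \<Longrightarrow> eval p d0 xs (fst (prod_decode (xs ! 0)))"
    "\<And>p xs. length xs = 1 \<Longrightarrow> eval p d1 xs (snd (prod_decode (xs ! 0)))"
    using functional_prod_decode[OF functional_nth[of 0 1]] unfolding functional_def by auto
  from this[of "[_]"] have
    d: "eval p d0 [t] (fst (prod_decode t))" "eval p d1 [t] (snd (prod_decode t))" for p t
    by simp_all
  have "total_computable K'"
    unfolding total_computable_def
  proof (intro exI allI)
    fix p t
    have "eval p (subst_oracle r e (length [snd (prod_decode t)]))
        ([snd (prod_decode t)] @ [fst (prod_decode t)]) (K' p t)"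
      unfolding K'_def by (rule eval_subst_oracle[OF r e])
    then show "eval p (Comp (subst_oracle r e 1) [d1, d0]) [t] (K' p t)"
      by (intro eval.eval_Comp[of p _ _ "[snd (prod_decode t), fst (prod_decode t)]"])
        (simp_all add: d)
  qed
  moreover have "baire_lim (K' p) = Some (K q)" if "baire_lim p = Some q" for p q
    unfolding baire_lim_iff
  proof
    fix k
    \<comment> \<open>The run that computes \<open>K q k\<close> from \<open>q\<close> also succeeds
      on all late rows, where determinism identifies its result with
      \<open>K (row p i) k\<close>.\<close>
    have "eventually (\<lambda>i. row p i m = q m) sequentially" for m
      using that unfolding baire_lim_iff row_def eventually_sequentially by blast
    then have "eventually (\<lambda>i. eval (row p i) e [k] (K q k)) sequentially"
      using e by (rule eventually_eval)
    then have "eventually (\<lambda>i. K (row p i) k = K q k) sequentially"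
      by (rule eventually_mono) (rule eval_deterministic[OF e])
    then show "\<exists>N. \<forall>i\<ge>N. K' p (prod_encode (i, k)) = K q k"
      unfolding eventually_sequentially K'_def by simp
  qed
  ultimately show ?thesis
    unfolding reduces_total_def jump_simps using H HK
    by (intro exI[of _ H] exI[of _ K']) blast
qed

lemma reduces_total_funpow_jump:
  "reduces_total f g \<Longrightarrow> reduces_total ((jump ^^ n) f) ((jump ^^ n) g)"
  by (induction n) (simp_all add: reduces_total_jump)

section \<open>The Bolzano-Weierstrass problem and closed choice\<close>

text \<open>The outer functional of all three reductions below. \<open>fin_rep\<close> reads
  position 0 only, and position 0 of a pair is position 0 of its first component, so the colour is
  read off an answer of \<open>CSRT\<close> in the same way.\<close>

lemma computable_const_head: "computable (\<lambda>q. Some (\<lambda>_. q 0))"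
proof -
  have "functional 1 (\<lambda>p xs. p 0)" by (intro functional_intros)
  then show ?thesis unfolding functional_def computable_def by force
qed

lemma infinite_value:
  fixes x :: baire
  assumes "range x \<subseteq> {0, 1}"
  obtains a where "a \<in> {0, 1}" "infinite {i. x i = a}"
proof -
  have "{i. x i = 0} \<union> {i. x i = 1} = UNIV" using assms by auto
  then show ?thesis using that by (metis finite_Un infinite_UNIV_nat insertI1 insertI2)
qed

text \<open>The limit of \<open>K p\<close> enumerates \<open>1 - p s\<close> as soon as \<open>p\<close> is constant from \<open>s\<close> on.\<close>

lemma BWT2_reduces_jump_C2: "reduces_total BWT2 (jump C2)"
proof -
  \<comment> \<open>The sum counts the \<open>j\<close> from \<open>s\<close> to below
    \<open>i\<close> at which \<open>p j\<close> differs from \<open>p s\<close>; it expresses a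
    bounded quantifier. Since the count never decreases with \<open>i\<close>, the entry at
    \<open>s\<close> changes at most once, to 0, which enumerates nothing.\<close>
  define K :: "baire \<Rightarrow> baire" where "K p t = (let i = fst (prod_decode t); s = snd (prod_decode t) in
    if (\<Sum>j<i. if s \<le> j then if p j = p s then 0 else 1 else 0) = (0::nat)
    then Suc (1 - p s) else 0)" for p t
  have "functional (Suc 1) (\<lambda>p xs. if snd (prod_decode (xs ! 1)) \<le> xs ! 0
      then if p (xs ! 0) = p (snd (prod_decode (xs ! 1))) then 0 else 1 else 0)"
    by (intro functional_intros functional_nth) auto
  from functional_sum[OF this functional_prod_decode(1)[OF functional_nth[of 0]]]
  have sum: "functional 1 (\<lambda>p xs. \<Sum>j<fst (prod_decode (xs ! 0)).
      if snd (prod_decode (xs ! 0)) \<le> j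
      then if p j = p (snd (prod_decode (xs ! 0))) then 0 else 1 else 0)"
    by (simp cong: if_cong)
  have "functional 1 (\<lambda>p xs. if (\<Sum>j<fst (prod_decode (xs ! 0)).
      if snd (prod_decode (xs ! 0)) \<le> j
      then if p j = p (snd (prod_decode (xs ! 0))) then 0 else 1 else 0) = (0::nat)
      then Suc (1 - p (snd (prod_decode (xs ! 0)))) else 0)"
    by (intro functional_intros functional_nth sum) auto
  then have K: "total_computable K"
    by (rule total_computable_functional) (simp add: K_def Let_def cong: if_cong)
  have K_encode: "K p (prod_encode (i, s)) =
      (if \<forall>j. s \<le> j \<and> j < i \<longrightarrow> p j = p s then Suc (1 - p s) else 0)" for p i s
  proof -
    have "(\<Sum>j<i. if s \<le> j then if p j = p s then 0 else 1 else 0) = (0::nat) \<longleftrightarrow>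
        (\<forall>j. s \<le> j \<and> j < i \<longrightarrow> p j = p s)"
      unfolding sum_eq_0_iff[OF finite_lessThan] by (metis lessThan_iff one_neq_zero)
    then show ?thesis by (simp only: K_def Let_def prod_encode_inverse fst_conv snd_conv)
  qed
  have K_limit: "in_rep (jump C2) (K x) = Some {a \<in> {0, 1}. infinite {i. x i = a}}"
    if x: "range x \<subseteq> {0, 1}" for x
  proof -
    define tail where "tail s \<longleftrightarrow> (\<forall>j\<ge>s. x j = x s)" for s
    define q where "q s = (if tail s then Suc (1 - x s) else 0)" for s
    have "\<exists>N. \<forall>i\<ge>N. K x (prod_encode (i, s)) = q s" for s
    proof (cases "tail s")
      case True
      have "K x (prod_encode (i, s)) = Suc (1 - x s)" for i
        unfolding K_encode using True unfolding tail_def by (intro if_P) blast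
      then show ?thesis using True by (simp add: q_def)
    next
      case False
      then obtain j where j: "j \<ge> s" "x j \<noteq> x s" unfolding tail_def by blast
      have "K x (prod_encode (i, s)) = 0" if "i \<ge> Suc j" for i
        unfolding K_encode using j that by (intro if_not_P) (auto intro: Suc_le_lessD)
      then show ?thesis using False by (auto simp: q_def)
    qed
    then have lim: "baire_lim (K x) = Some q" unfolding baire_lim_iff by blast
    have xv: "x i = 0 \<or> x i = 1" for i using x by (auto simp: image_subset_iff)
    \<comment> \<open>For a binary sequence, a value occurs only finitely often exactly if the
      sequence is eventually constant with the other value, which some tail detects.\<close>
    have "Suc a \<in> range q \<longleftrightarrow> a \<in> {0, 1} \<and> finite {i. x i = a}" for a
    proof
      assume "Suc a \<in> range q"
      then obtain s where s: "tail s" "a = 1 - x s"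
        by (auto simp: q_def split: if_splits)
      have "i < s" if "x i = a" for i
      proof (rule ccontr)
        assume "\<not> i < s"
        then have "x i = x s" using s(1) by (metis tail_def not_less)
        then show False using that s(2) xv[of s] by auto
      qed
      then have "{i. x i = a} \<subseteq> {..<s}" by blast
      then have "finite {i. x i = a}" by (rule finite_subset) simp
      then show "a \<in> {0, 1} \<and> finite {i. x i = a}"
        using s(2) xv[of s] by auto
    next
      assume a: "a \<in> {0, 1} \<and> finite {i. x i = a}"
      then obtain s where s: "\<forall>i\<in>{i. x i = a}. i < s" using finite_nat_set_iff_bounded by blast
      have "x j = 1 - a" if "j \<ge> s" for j
      proof -
        have "x j \<noteq> a" using s that by (auto simp: not_less[symmetric])
        then show ?thesis using a xv[of j] by auto
      qed
      then have "q s = Suc a" using a by (auto simp: q_def tail_def)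
      then show "Suc a \<in> range q" by (metis rangeI)
    qed
    then have "neg_rep2 q = Some {a \<in> {0, 1}. infinite {i. x i = a}}"
      unfolding neg_rep2_def by auto
    with lim show ?thesis unfolding jump_simps by (auto simp: C2_def)
  qed
  have "\<exists>z. in_rep (jump C2) (K p) = Some z \<and> mmap (jump C2) z \<noteq> {} \<and>
      (\<forall>q y. out_rep (jump C2) q = Some y \<and> y \<in> mmap (jump C2) z \<longrightarrow>
        (\<exists>q' y'. Some (\<lambda>_. q 0) = Some q' \<and> out_rep BWT2 q' = Some y' \<and> y' \<in> mmap BWT2 x))"
    if "in_rep BWT2 p = Some x" for p x
  proof -
    have x: "x = p" "range x \<subseteq> {0, 1}"
      using that by (auto simp: BWT2_def binary_rep_def split: if_splits)
    obtain a where "a \<in> {0, 1}" "infinite {i. x i = a}" by (rule infinite_value[OF x(2)])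
    then show ?thesis
      using K_limit[OF x(2)] x
      by (auto simp: jump_simps C2_def BWT2_def fin_rep_def split: if_splits)
  qed
  then show ?thesis
    unfolding reduces_total_def using K computable_const_head
    by (intro exI[of _ "\<lambda>q. Some (\<lambda>_. q 0)"] exI[of _ K]) simp
qed

text \<open>\<open>K p i\<close> is the value other than the first one that the \<open>i\<close>-th approximation enumerates into the
  complement; \<open>s p i\<close> is the position of the latter, searched only below \<open>i\<close>.\<close>

lemma jump_C2_reduces_BWT2: "reduces_total (jump C2) BWT2"
proof -
  \<comment> \<open>\<open>xs ! 0\<close> is the candidate position and \<open>xs ! 1\<close> the
    stage, which bounds the search. Only 1 and 2 enumerate an element of \<open>{0, 1}\<close>;
    other nonzero entries may occur in the approximations, but not in the limit.\<close>
  define G :: "baire \<Rightarrow> nat list \<Rightarrow> nat" where "G p xs = (if xs ! 1 \<le> xs ! 0 then 0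
    else if p (prod_encode (xs ! 1, xs ! 0)) = 1 then 0
    else if p (prod_encode (xs ! 1, xs ! 0)) = 2 then 0 else 1)" for p xs
  define s where "s p i = (LEAST s. G p [s, i] = 0)" for p i
  \<comment> \<open>An entry 1 removes 0 and calls for the answer 1; an entry 2 removes 1 and gives
    the default 0. If the search ends at its bound, the entry there is read all the same. This is
    harmless: when the limit removes nothing, any binary answer is correct.\<close>
  define K where "K p i = (if p (prod_encode (i, s p i)) = 1 then 1 else 0::nat)" for p i
  have "functional (Suc 1) G"
    unfolding G_def by (intro functional_intros functional_nth) auto
  moreover have "\<exists>n. G p (n # xs) = 0" for p xs
    by (rule exI[of _ "xs ! 0"]) (simp add: G_def)
  ultimately have least: "functional 1 (\<lambda>p xs. LEAST n. G p (n # xs) = 0)"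
    by (rule functional_Least)
  have "functional 1 (\<lambda>p xs. if p (prod_encode (xs ! 0, LEAST n. G p (n # xs) = 0)) = 1
      then 1 else 0)"
    by (intro functional_intros functional_nth least) auto
  then have K: "total_computable K"
    by (rule total_computable_functional) (simp add: K_def s_def)
  have binary: "range (K p) \<subseteq> {0, 1}" for p by (auto simp: K_def)
  have sound: "a \<in> A"
    if lim: "baire_lim p = Some q" and q: "neg_rep2 q = Some A" and ne: "A \<noteq> {}"
      and a: "infinite {i. K p i = a}" for p q A a
  proof -
    have A: "A = {0, 1} - {a. Suc a \<in> range q}" and sub: "{a. Suc a \<in> range q} \<subseteq> {0, 1}"
      using q by (auto simp: neg_rep2_def split: if_splits)
    have a01: "a = 0 \<or> a = 1"
    proof -
      obtain i where "a = K p i" using a unfolding infinite_nat_iff_unbounded_le by blast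
      then show ?thesis by (simp add: K_def)
    qed
    have qv: "q m = 0 \<or> q m = 1 \<or> q m = 2" for m
    proof (cases "q m")
      case (Suc b)
      then have "Suc b \<in> range q" by (metis rangeI)
      then show ?thesis using sub Suc by auto
    qed simp
    show ?thesis
    proof (cases "\<exists>m. q m \<noteq> 0")
      case False
      then show ?thesis using A a01 by auto
    next
      case True
      define m where "m = (LEAST m. q m \<noteq> 0)"
      have m: "q m \<noteq> 0" "\<And>l. l < m \<Longrightarrow> q l = 0"
        unfolding m_def using LeastI_ex[OF True] not_less_Least by blast+
      have "eventually (\<lambda>i. p (prod_encode (i, l)) = q l) sequentially" for l
        using lim unfolding baire_lim_iff eventually_sequentially by blast
      \<comment> \<open>Agreement is needed on all positions up to \<open>m\<close>, so that the
        search passes those below \<open>m\<close> and stops at \<open>m\<close>. Stages beyond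
        \<open>m\<close> keep the bound from interfering.\<close>
      then have "eventually (\<lambda>i. \<forall>l\<in>{..m}. p (prod_encode (i, l)) = q l) sequentially"
        by (intro eventually_ball_finite) auto
      then have "eventually (\<lambda>i. K p i = (if q m = 1 then 1 else 0)) sequentially"
        using eventually_gt_at_top[of m]
      proof eventually_elim
        case (elim i)
        have "s p i = m"
          unfolding s_def
        proof (rule Least_equality)
          show "G p [m, i] = 0" using elim qv[of m] m(1) by (auto simp: G_def)
          fix l assume l: "G p [l, i] = 0"
          show "m \<le> l"
          proof (rule ccontr)
            assume "\<not> m \<le> l"
            then show False using l elim m(2)[of l] by (auto simp: G_def split: if_splits)
          qed
        qed
        then show ?case using elim by (auto simp: K_def)
      qed
      then obtain N where N: "\<And>i. i \<ge> N \<Longrightarrow> K p i = (if q m = 1 then 1 else 0)"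
        unfolding eventually_sequentially by blast
      obtain i where "i \<ge> N" "K p i = a"
        using a unfolding infinite_nat_iff_unbounded_le by blast
      then have av: "a = (if q m = 1 then 1 else 0)" using N by auto
      \<comment> \<open>As \<open>1 - a\<close> is enumerated into the complement, an element of the
        nonempty set \<open>A\<close> can only be \<open>a\<close>.\<close>
      obtain b where b: "b \<in> A" using ne by blast
      have "Suc (1 - a) = q m" using av m(1) qv[of m] by auto
      then have "Suc (1 - a) \<in> range q" by simp
      then show ?thesis using b A a01 by auto
    qed
  qed
  have "mmap BWT2 (K p) \<noteq> {}" for p
    by (rule infinite_value[OF binary[of p]]) (use binary[of p] in \<open>auto simp: BWT2_def\<close>)
  moreover have "\<exists>q' y'. Some (\<lambda>_. q 0) = Some q' \<and> out_rep (jump C2) q' = Some y' \<and>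
      y' \<in> mmap (jump C2) A"
    if p: "in_rep (jump C2) p = Some A" and ne: "mmap (jump C2) A \<noteq> {}"
      and q: "out_rep BWT2 q = Some y" "y \<in> mmap BWT2 (K p)" for p A q y
  proof -
    obtain r where r: "baire_lim p = Some r" "neg_rep2 r = Some A"
      using p by (auto simp: jump_simps C2_def)
    have A: "A \<noteq> {}" "A \<subseteq> {0, 1}" using ne by (auto simp: jump_simps C2_def)
    have y: "q 0 = y" "y < 2" "infinite {i. K p i = y}"
      using q by (auto simp: BWT2_def fin_rep_def split: if_splits)
    have "y \<in> A" by (rule sound[OF r A(1) y(3)])
    then show ?thesis using A(2) y(1,2) by (simp add: jump_simps C2_def fin_rep_def)
  qed
  moreover have "in_rep BWT2 (K p) = Some (K p)" for p
    using binary[of p] by (simp add: BWT2_def binary_rep_def)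
  ultimately have "\<exists>z. in_rep BWT2 (K p) = Some z \<and> mmap BWT2 z \<noteq> {} \<and>
      (\<forall>q y. out_rep BWT2 q = Some y \<and> y \<in> mmap BWT2 z \<longrightarrow>
        (\<exists>q' y'. Some (\<lambda>_. q 0) = Some q' \<and> out_rep (jump C2) q' = Some y' \<and>
          y' \<in> mmap (jump C2) A))"
    if "in_rep (jump C2) p = Some A" "mmap (jump C2) A \<noteq> {}" for p A
    using that by blast
  then show ?thesis
    unfolding reduces_total_def using K computable_const_head
    by (intro exI[of _ "\<lambda>q. Some (\<lambda>_. q 0)"] exI[of _ K]) simp
qed

section \<open>Stable Ramsey\<close>

text \<open>The least element is innermost and the greatest outermost, so that the greatest element
  selects the row over which \<open>baire_lim\<close> takes the limit.\<close>

definition set_code :: "nat set \<Rightarrow> nat" where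
  "set_code A = (let l = sorted_list_of_set A in
    foldl (\<lambda>c a. prod_encode (a, c)) (hd l) (tl l))"

lemma set_code_singleton: "set_code {k} = k"
  by (simp add: set_code_def)

lemma set_code_insert:
  assumes "finite A" "A \<noteq> {}" "\<forall>a\<in>A. a < i"
  shows "set_code (insert i A) = prod_encode (i, set_code A)"
proof -
  have "sorted_list_of_set (insert i A) = sorted_list_of_set A @ [i]"
    by (rule sorted_list_of_set_unique[THEN iffD1])
      (use assms in \<open>auto simp: sorted_wrt_append card_insert_if\<close>)
  moreover have "sorted_list_of_set A \<noteq> []" using assms by simp
  ultimately show ?thesis by (simp add: set_code_def Let_def)
qed

lemma finite_theta: "finite (theta n t)"
  by (induction n t rule: theta.induct) (auto split: prod.split)

text \<open>The recursive clause of \<open>theta\<close> shifts the remaining set beyond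
  \<open>i\<close>, so each unfolding peels off the least element.\<close>

lemma sorted_list_insert_shift:
  assumes "finite B"
  shows "sorted_list_of_set (insert i ((+) (Suc i) ` B)) =
    i # sorted_list_of_set ((+) (Suc i) ` B)"
  using assms by (intro sorted_list_of_set_unique[THEN iffD1]) (auto simp: card_insert_if)

text \<open>Generalised for induction on \<open>n\<close>: \<open>xs ! 0\<close> is the code
  accumulated so far, \<open>xs ! 1\<close> the total shift, and \<open>xs ! 2\<close> the code of
  the elements still to come. \<open>theta\<close> yields its elements in increasing order, which is
  the order in which the fold consumes them. Each \<open>n\<close> gets its own program.\<close>

lemma functional_fold_theta:
  "functional 3 (\<lambda>p xs. foldl (\<lambda>c a. prod_encode (a, c)) (xs ! 0)
    (sorted_list_of_set ((+) (xs ! 1) ` theta (Suc n) (xs ! 2))))"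
proof (induction n)
  case 0
  have "functional 3 (\<lambda>p xs. prod_encode (xs ! 1 + xs ! 2, xs ! 0))"
    by (intro functional_intros functional_nth) auto
  then show ?case by simp
next
  case (Suc n)
  have step: "sorted_list_of_set ((+) b ` theta (Suc (Suc n)) t) =
      (b + fst (prod_decode t)) # sorted_list_of_set
        ((+) (Suc (b + fst (prod_decode t))) ` theta (Suc n) (snd (prod_decode t)))" for b t
  proof -
    have "(+) b ` theta (Suc (Suc n)) t = insert (b + fst (prod_decode t))
        ((+) (Suc (b + fst (prod_decode t))) ` theta (Suc n) (snd (prod_decode t)))"
      by (simp add: image_image add.assoc split: prod.split)
    then show ?thesis by (simp only: sorted_list_insert_shift finite_theta)
  qed
  have "functional 3 (\<lambda>p xs. prod_encode (xs ! 1 + fst (prod_decode (xs ! 2)), xs ! 0))"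
    "functional 3 (\<lambda>p xs. Suc (xs ! 1 + fst (prod_decode (xs ! 2))))"
    "functional 3 (\<lambda>p xs. snd (prod_decode (xs ! 2)))"
    by (intro functional_intros functional_nth; simp)+
  from functional_comp3[OF Suc.IH this] show ?case
    unfolding step by (simp del: theta.simps)
qed

lemma functional_set_code_theta:
  "functional 1 (\<lambda>p xs. set_code (theta (Suc (Suc n)) (xs ! 0)))"
proof -
  have "sorted_list_of_set (theta (Suc (Suc n)) t) =
      fst (prod_decode t) # sorted_list_of_set
        ((+) (Suc (fst (prod_decode t))) ` theta (Suc n) (snd (prod_decode t)))" for t
  proof -
    have "theta (Suc (Suc n)) t = insert (fst (prod_decode t))
        ((+) (Suc (fst (prod_decode t))) ` theta (Suc n) (snd (prod_decode t)))"
      by (simp split: prod.split)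
    then show ?thesis by (simp only: sorted_list_insert_shift finite_theta)
  qed
  then have code: "set_code (theta (Suc (Suc n)) t) = foldl (\<lambda>c a. prod_encode (a, c))
      (fst (prod_decode t)) (sorted_list_of_set
        ((+) (Suc (fst (prod_decode t))) ` theta (Suc n) (snd (prod_decode t))))" for t
    unfolding set_code_def by (simp del: theta.simps)
  have "functional 1 (\<lambda>p xs. fst (prod_decode (xs ! 0)))"
    "functional 1 (\<lambda>p xs. Suc (fst (prod_decode (xs ! 0))))"
    "functional 1 (\<lambda>p xs. snd (prod_decode (xs ! 0)))"
    by (intro functional_intros functional_nth; simp)+
  from functional_comp3[OF functional_fold_theta this] show ?thesis
    unfolding code by (simp del: theta.simps)
qed

section \<open>Limits along homogeneous sets and the reduction to stable Ramsey\<close>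

lemma funpow_jump_simps:
  "out_rep ((jump ^^ n) P) = out_rep P" "mmap ((jump ^^ n) P) = mmap P"
  by (induction n) (simp_all add: jump_simps)

text \<open>Each induction step removes the outermost limit: extending \<open>A\<close> by ever
  larger elements of \<open>M\<close> keeps the colour \<open>j\<close>, so the limit gives
  \<open>A\<close> the colour \<open>j\<close> too. After \<open>m\<close> steps \<open>x\<close>
  itself is left, where the cut-off has no effect because \<open>x\<close> is binary.\<close>

lemma homogeneous_imp_constant:
  assumes "in_rep ((jump ^^ m) BWT2) p = Some x" "infinite M"
    and "\<And>A. A \<in> [M]\<^bsup>Suc m\<^esup> \<Longrightarrow> min 1 (p (set_code A)) = j" and "k \<in> M"
  shows "x k = j"
  using assms(1,3)
proof (induction m arbitrary: p)
  case 0
  then have "x = p" and "range x \<subseteq> {0, 1}"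
    by (auto simp: BWT2_def binary_rep_def split: if_splits)
  then have "p k \<in> {0, 1}" by blast
  moreover have "{k} \<in> [M]\<^bsup>Suc 0\<^esup>" using \<open>k \<in> M\<close> by (simp add: nsets_def)
  ultimately show ?case using "0.prems"(2)[of "{k}"] \<open>x = p\<close>
    by (auto simp: set_code_singleton)
next
  case (Suc m)
  then obtain q where lim: "baire_lim p = Some q" and q: "in_rep ((jump ^^ m) BWT2) q = Some x"
    by (auto simp: jump_simps)
  have "min 1 (q (set_code A)) = j" if A: "A \<in> [M]\<^bsup>Suc m\<^esup>" for A
  proof -
    obtain N where N: "\<And>i. i \<ge> N \<Longrightarrow> p (prod_encode (i, set_code A)) = q (set_code A)"
      using lim unfolding baire_lim_iff by blast
    have fin: "finite A" "A \<noteq> {}" "A \<subseteq> M" "card A = Suc m" using A by (auto simp: nsets_def)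
    \<comment> \<open>Past \<open>Max A\<close>, \<open>i\<close> becomes the outermost index of the
      code; past \<open>N\<close>, its row agrees with the limit at
      \<open>set_code A\<close>.\<close>
    obtain i where i: "i > max N (Max A)" "i \<in> M"
      using \<open>infinite M\<close> unfolding infinite_nat_iff_unbounded by blast
    then have less: "\<forall>a\<in>A. a < i" using fin(1) by (auto simp: le_less_trans[OF Max_ge])
    then have "i \<notin> A" by blast
    then have "insert i A \<in> [M]\<^bsup>Suc (Suc m)\<^esup>" using fin i(2) by (auto simp: nsets_def)
    from Suc.prems(2)[OF this] show ?thesis
      using set_code_insert[OF fin(1,2) less] N[of i] i(1) by simp
  qed
  with q show ?case by (rule Suc.IH)
qed

lemma hom_color_eq:
  assumes "infinite M" "\<And>A. A \<in> [M]\<^bsup>n\<^esup> \<Longrightarrow> c A = j"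
  shows "hom_color n c M = j"
proof -
  obtain A where "A \<in> [M]\<^bsup>n\<^esup>"
    using infinite_arbitrarily_large[OF assms(1), of n] by (auto simp: nsets_def)
  then show ?thesis unfolding hom_color_def using assms(2) by (intro the_equality) auto
qed

text \<open>Ramsey's theorem, needed to see that the colouring passed to \<open>CSRT\<close> lies in
  its domain.\<close>

lemma infinite_homogeneous:
  assumes "c \<in> colorings n k"
  obtains M where "infinite M" "homogeneous n c M"
proof -
  have "\<forall>X. X \<subseteq> UNIV \<and> finite X \<and> card X = n \<longrightarrow> c X < k"
    using assms by (auto simp: colorings_def nsets_def PiE_iff)
  from Ramsey[OF infinite_UNIV_nat this] show ?thesis
    using that by (fastforce simp: homogeneous_def nsets_def)
qed

text \<open>The \<open>Suc m\<close> jumps are \<open>Suc m\<close> nested limits; their indices and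
  the argument of the binary sequence make up the \<open>Suc (Suc m)\<close> points of a coloured
  set.\<close>

lemma BWT2_jump_reduces_CSRT:
  "reduces_total ((jump ^^ Suc m) BWT2) (CSRT (Suc (Suc m)) 2)"
proof -
  let ?n = "Suc (Suc m)"
  \<comment> \<open>The cut-off is needed because approximations may be arbitrary numbers; the
    restriction makes \<open>c p\<close> extensional, as \<open>colorings\<close> demands.\<close>
  define c where "c p = (\<lambda>A\<in>[UNIV]\<^bsup>?n\<^esup>. min 1 (p (set_code A)))" for p :: baire
  define K :: "baire \<Rightarrow> baire" where "K p t = min 1 (p (set_code (theta ?n t)))" for p t
  have "functional 1 (\<lambda>p xs. if 1 \<le> p (set_code (theta ?n (xs ! 0))) then 1
      else p (set_code (theta ?n (xs ! 0))))"
    by (intro functional_intros functional_set_code_theta)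
  then have K: "total_computable K"
    by (rule total_computable_functional) (simp add: K_def min_def del: theta.simps)
  have c: "c p \<in> colorings ?n 2" for p by (auto simp: c_def colorings_def)
  have rep: "coloring_rep ?n 2 (K p) = Some (c p)" for p
  proof -
    have "theta ?n t \<in> [UNIV]\<^bsup>?n\<^esup>" for t
      using bij_theta[of ?n] by (auto simp: bij_betw_def simp del: theta.simps)
    then have "K p t = c p (theta ?n t)" for t
      by (simp add: K_def c_def del: theta.simps)
    with c show ?thesis by (subst coloring_rep_iff) auto
  qed
  have stable: "stable ?n (c p)" if lim: "baire_lim p = Some q" for p q
    unfolding stable_def
  proof
    fix A assume "A \<in> nsets (UNIV :: nat set) (?n - 1)"
    then have A: "finite A" "A \<noteq> {}" "card A = Suc m" by (auto simp: nsets_def)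
    obtain N where N: "\<And>i. i \<ge> N \<Longrightarrow> p (prod_encode (i, set_code A)) = q (set_code A)"
      using lim unfolding baire_lim_iff by blast
    have "c p (A \<union> {i}) = min 1 (q (set_code A))" if "i > max N (Max A)" for i
    proof -
      have less: "\<forall>a\<in>A. a < i" using A(1) that by (auto simp: le_less_trans[OF Max_ge])
      then have "i \<notin> A" by blast
      then have "insert i A \<in> [UNIV]\<^bsup>?n\<^esup>" using A by (auto simp: nsets_def)
      then show ?thesis
        using set_code_insert[OF A(1,2) less] N[of i] that by (simp add: c_def)
    qed
    then have "eventually (\<lambda>i. c p (A \<union> {i}) = min 1 (q (set_code A))) sequentially"
      unfolding eventually_sequentially by (meson Suc_le_lessD)
    then show "convergent (\<lambda>i. c p (A \<union> {i}))"
      by (auto simp: convergent_def tendsto_discrete)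
  qed
  have sound: "infinite {i. x i = hom_color ?n (c p) M}"
    if x: "in_rep ((jump ^^ Suc m) BWT2) p = Some x"
      and M: "infinite M" and hom: "homogeneous ?n (c p) M" for p x M
  proof -
    obtain j where j: "\<And>A. A \<in> [M]\<^bsup>?n\<^esup> \<Longrightarrow> c p A = j"
      using hom unfolding homogeneous_def by blast
    have "min 1 (p (set_code A)) = j" if "A \<in> [M]\<^bsup>?n\<^esup>" for A
      using j[OF that] that by (auto simp: c_def nsets_def)
    then have "x k = j" if "k \<in> M" for k
      using homogeneous_imp_constant[OF x M _ that] by blast
    then have "M \<subseteq> {i. x i = j}" by blast
    then have "infinite {i. x i = j}" using M by (rule infinite_super)
    then show ?thesis using hom_color_eq[OF M j] by simp
  qed
  have "\<exists>z. in_rep (CSRT ?n 2) (K p) = Some z \<and> mmap (CSRT ?n 2) z \<noteq> {} \<and>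
      (\<forall>q y. out_rep (CSRT ?n 2) q = Some y \<and> y \<in> mmap (CSRT ?n 2) z \<longrightarrow>
        (\<exists>q' y'. Some (\<lambda>_. q 0) = Some q' \<and> out_rep ((jump ^^ Suc m) BWT2) q' = Some y' \<and>
          y' \<in> mmap ((jump ^^ Suc m) BWT2) x))"
    if x: "in_rep ((jump ^^ Suc m) BWT2) p = Some x"
      and ne: "mmap ((jump ^^ Suc m) BWT2) x \<noteq> {}" for p x
  proof (intro exI[of _ "c p"] conjI allI impI)
    show "in_rep (CSRT ?n 2) (K p) = Some (c p)" by (simp add: CSRT_def rep)
    obtain q where "baire_lim p = Some q" using x by (auto simp: jump_simps)
    then have st: "stable ?n (c p)" by (rule stable)
    obtain M where "infinite M" "homogeneous ?n (c p) M" by (rule infinite_homogeneous[OF c])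
    then show "mmap (CSRT ?n 2) (c p) \<noteq> {}" using c st by (auto simp: CSRT_def)
    fix r y assume y: "out_rep (CSRT ?n 2) r = Some y \<and> y \<in> mmap (CSRT ?n 2) (c p)"
    then obtain M where M: "y = (hom_color ?n (c p) M, M)" "infinite M" "homogeneous ?n (c p) M"
      by (auto simp: CSRT_def)
    have r: "r 0 < 2" "r 0 = hom_color ?n (c p) M"
      using y M(1) by (auto simp: CSRT_def prod_rep_def fin_rep_def split: option.splits if_splits)
    have "range x \<subseteq> {0, 1}" using ne unfolding funpow_jump_simps by (auto simp: BWT2_def)
    then have "r 0 \<in> mmap ((jump ^^ Suc m) BWT2) x"
      using sound[OF x M(2,3)] r unfolding funpow_jump_simps by (simp add: BWT2_def)
    moreover have "out_rep ((jump ^^ Suc m) BWT2) (\<lambda>_. r 0) = Some (r 0)"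
      using r(1) unfolding funpow_jump_simps by (simp add: BWT2_def fin_rep_def)
    ultimately show "\<exists>q' y'. Some (\<lambda>_. r 0) = Some q' \<and>
        out_rep ((jump ^^ Suc m) BWT2) q' = Some y' \<and> y' \<in> mmap ((jump ^^ Suc m) BWT2) x"
      by blast
  qed
  then show ?thesis
    unfolding reduces_total_def using K computable_const_head by blast
qed

theorem theorem3p5:
  fixes n :: nat
  assumes "n \<ge> 2"
  shows "(jump ^^ (n - 1)) BWT2 \<equiv>\<^sub>s\<^sub>W (jump ^^ n) C2 \<and>
         (jump ^^ n) C2 \<le>\<^sub>s\<^sub>W CSRT n 2"
proof -
  obtain m where n: "n = Suc (Suc m)" using assms by (metis add_2_eq_Suc le_Suc_ex)
  \<comment> \<open>Moving one jump inside leaves \<open>n - 1\<close> outer jumps on both sides, so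
    that the comparison of \<open>BWT2\<close> with \<open>jump C2\<close> can be lifted.\<close>
  have C2: "(jump ^^ n) C2 = (jump ^^ (n - 1)) (jump C2)"
    by (simp add: n funpow_swap1)
  have "(jump ^^ (n - 1)) BWT2 \<le>\<^sub>s\<^sub>W (jump ^^ n) C2" "(jump ^^ n) C2 \<le>\<^sub>s\<^sub>W (jump ^^ (n - 1)) BWT2"
    unfolding C2 by (intro sW_le_if_reduces_total reduces_total_funpow_jump
        BWT2_reduces_jump_C2 jump_C2_reduces_BWT2)+
  moreover have "(jump ^^ (n - 1)) BWT2 \<le>\<^sub>s\<^sub>W CSRT n 2"
    using sW_le_if_reduces_total[OF BWT2_jump_reduces_CSRT[of m]] by (simp add: n)
  ultimately show ?thesis unfolding sW_equiv_def using sW_le_trans by blast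
qed

end
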